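(* Let $1<\upsilon<2$, $0<\mu<1$, $b\in\mathbb{N}$, $I=\{0,1,\dots,b+1\}$, let $\alpha\in\mathbb{R}$ with $|\alpha|<1$, and assume $e_{\upsilon-\mu,\upsilon}(\alpha,b+2)\ne0$. Assume that $f:[\upsilon-1,\upsilon+b]_{\mathbb{N}_{\upsilon-1}}\times\mathbb{R}\to\mathbb{R}$ is continuous and that there is $m\in\mathbb{R}$ with $$\lim_{|r|\to\infty}\frac{f(t+\upsilon-1,r)}{r}=m\quad\text{for all }t\in I.$$ If $$|m|<d:=\frac{1}{\displaystyle\max_{t\in[\upsilon-2,\upsilon+b+1]_{\mathbb{N}_{\upsilon-2}}}\sum_{s=\upsilon-1}^{\upsilon+b}|G(t,s)|},$$ then the boundary value problem $$-\Delta^{\upsilon}y(t)+\alpha\,\Delta^{\mu}y(t+\upsilon-\mu)=f(t+\upsilon-1,y(t+\upsilon-1)),\quad t\in I,$$ $$y(\upsilon-2)=y(\upsilon+b+1)=0,$$ has a solution $y:[\upsilon-2,\upsilon+b+1]_{\mathbb{N}_{\upsilon-2}}\to\mathbb{R}$; moreover, $y\not\equiv0$ on $[\upsilon-2,\upsilon+b+1]_{\mathbb{N}_{\upsilon-2}}$ when $f(t+\upsilon-1,0)\neq0$ for at least one $t\in I$.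
   Context: Notation: $\mathbb{N}=\{1,2,\dots\}$. For $a\in\mathbb{R}$, $\mathbb{N}_a=\{a,a+1,a+2,\dots\}$, and $[c,c+n]_{\mathbb{N}_c}=\{c,c+1,\dots,c+n\}$. Sums $\sum_{s=\upsilon-1}^{\upsilon+b}$ run over $s=\upsilon-1,\upsilon,\dots,\upsilon+b$. $\Delta$ is the forward difference, $\Delta f(t)=f(t+1)-f(t)$. Falling factorial: $t^{(\nu)}=\frac{\Gamma(t+1)}{\Gamma(t+1-\nu)}$ whenever the right-hand side is well defined, with $t^{(\nu)}=0$ if $t+1-\nu$ is a pole of $\Gamma$ and $t+1$ is not. Fractional sum: for $\nu>0$ and $f$ defined on $\mathbb{N}_a$, $\Delta^{-\nu}f(t)=\frac{1}{\Gamma(\nu)}\sum_{s=a}^{t-\nu}(t-s-1)^{(\nu-1)}f(s)$ (the sum running over $s=a,a+1,\dots,t-\nu$), for $t\in\mathbb{N}_{a+\nu}$. Riemann–Liouville fractional difference: $\Delta^{\nu}f(t)=\Delta^{N}\Delta^{\nu-N}f(t)$, with $N\in\mathbb{N}$, $N-1<\nu\le N$. In the equation, $\Delta^{\upsilon}y$ is taken with $y$ based at $a=\upsilon-2$, i.e. $\Delta^{\upsilon}y(t)=\Delta^2 S(t)$ with $S(\tau)=\frac{1}{\Gamma(2-\upsilon)}\sum_{s=\upsilon-2}^{\tau-2+\upsilon}(\tau-s-1)^{(1-\upsilon)}y(s)$. The term $\Delta^{\mu}y(t+\upsilon-\mu)$ means $(\Delta^{\mu}Y_1)(t)$, where $Y_1(t)=y(t+\upsilon-\mu)$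 is regarded as a function based at $a=\mu-1$, i.e. $\Delta^{\mu}y(t+\upsilon-\mu)=\Delta T(t)$ with $T(\tau)=\frac{1}{\Gamma(1-\mu)}\sum_{s=\mu-1}^{\tau-1+\mu}(\tau-s-1)^{(-\mu)}y(s+\upsilon-\mu)$. For $t\in I$ these expressions only involve values of $y$ on $[\upsilon-2,\upsilon+b+1]_{\mathbb{N}_{\upsilon-2}}$. Delta discrete Mittag-Leffler function: for $p>0$, $q\in\mathbb{R}$, $|\lambda|<1$ and an integer $n\ge -1$, $$e_{p,q}(\lambda,n)=\sum_{k=0}^{\infty}\lambda^k\frac{(n+kp+q-1)^{(kp+q-1)}}{\Gamma(kp+q)};$$ in particular, $e_{\upsilon-\mu,\upsilon}(\alpha,-1)=0$. Green's function: for $t\in[\upsilon-2,\upsilon+b+1]_{\mathbb{N}_{\upsilon-2}}$ and $s\in[\upsilon-1,\upsilon+b]_{\mathbb{N}_{\upsilon-1}}$, $$G(t,s)=\begin{cases}\dfrac{e_{\upsilon-\mu,\upsilon}(\alpha,t-\upsilon+1)}{e_{\upsilon-\mu,\upsilon}(\alpha,b+2)}\,e_{\upsilon-\mu,\upsilon}(\alpha,\upsilon+b-s)-e_{\upsilon-\mu,\upsilon}(\alpha,t-s-1), & s\le t,\\[2ex] \dfrac{e_{\upsilon-\mu,\upsilon}(\alpha,t-\upsilon+1)}{e_{\upsilon-\mu,\upsilon}(\alpha,b+2)}\,e_{\upsilon-\mu,\upsilon}(\alpha,\upsilon+b-s), & t+1\le s.\end{cases}$$ *)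

theory Defs
  imports "HOL-Analysis.Analysis"
begin

text \<open>
  Functions on \<open>{a, a + 1, a + 2, \<dots>}\<close> are represented by total functions on the reals, of which only
  the values at the grid points matter.
\<close>

definition grid_from :: "real \<Rightarrow> real set" where
  "grid_from a = {a + real k |k. True}"

definition grid :: "real \<Rightarrow> real \<Rightarrow> real set" where
  "grid c d = {s \<in> grid_from c. s \<le> d}"

text \<open>
  As \<open>Gamma\<close> is \<open>0\<close> at its poles and \<open>x / 0 = 0\<close>, the value is \<open>0\<close> if \<open>t + 1 - \<nu>\<close> is a pole, as required.
  The value carries no meaning if \<open>t + 1\<close> is a pole.
\<close>

definition falling :: "real \<Rightarrow> real \<Rightarrow> real" where
  "falling t \<nu> = Gamma (t + 1) / Gamma (t + 1 - \<nu>)"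

definition fdiff :: "(real \<Rightarrow> real) \<Rightarrow> real \<Rightarrow> real" where
  "fdiff f t = f (t + 1) - f t"

text \<open>
  The fractional sum of order \<open>\<nu> \<ge> 0\<close> of \<open>f\<close> based at \<open>a\<close>, for \<open>t \<in> grid_from (a + \<nu>)\<close>.
  The sum of order \<open>0\<close> is the identity; it only serves fractional differences of integer order.
\<close>

definition frac_sum :: "real \<Rightarrow> real \<Rightarrow> (real \<Rightarrow> real) \<Rightarrow> real \<Rightarrow> real" where
  "frac_sum a \<nu> f t =
     (if \<nu> = 0 then f t
      else 1 / Gamma \<nu> * (\<Sum>s\<in>grid a (t - \<nu>). falling (t - s - 1) (\<nu> - 1) * f s))"

text \<open>Riemann--Liouville difference of order \<open>\<nu> > 0\<close> of \<open>f\<close> based at \<open>a\<close>.\<close>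

definition frac_diff :: "real \<Rightarrow> real \<Rightarrow> (real \<Rightarrow> real) \<Rightarrow> real \<Rightarrow> real" where
  "frac_diff a \<nu> f =
     (let N = nat \<lceil>\<nu>\<rceil> in (fdiff ^^ N) (frac_sum a (real N - \<nu>) f))"

text \<open>
  The delta discrete Mittag-Leffler function. The argument \<open>n\<close> has type \<open>real\<close> because it is a difference
  of grid points; only integers \<open>n \<ge> -1\<close> are meant.
\<close>

definition mittag_leffler :: "real \<Rightarrow> real \<Rightarrow> real \<Rightarrow> real \<Rightarrow> real" where
  "mittag_leffler p q x n =
     (\<Sum>k. x ^ k * (falling (n + real k * p + q - 1) (real k * p + q - 1) / Gamma (real k * p + q)))"

text \<open>For \<open>t\<close> and \<open>s\<close> in the grids below, \<open>\<not> s \<le> t\<close> amounts to \<open>t + 1 \<le> s\<close>.\<close>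

definition green :: "real \<Rightarrow> real \<Rightarrow> real \<Rightarrow> nat \<Rightarrow> real \<Rightarrow> real \<Rightarrow> real" where
  "green \<upsilon> \<mu> \<alpha> b t s =
     (let e = mittag_leffler (\<upsilon> - \<mu>) \<upsilon> \<alpha> in
      if s \<le> t
      then e (t - \<upsilon> + 1) / e (real b + 2) * e (\<upsilon> + real b - s) - e (t - s - 1)
      else e (t - \<upsilon> + 1) / e (real b + 2) * e (\<upsilon> + real b - s))"

definition green_bound :: "real \<Rightarrow> real \<Rightarrow> real \<Rightarrow> nat \<Rightarrow> real" where
  "green_bound \<upsilon> \<mu> \<alpha> b =
     1 / (MAX t\<in>grid (\<upsilon> - 2) (\<upsilon> + real b + 1).
            \<Sum>s\<in>grid (\<upsilon> - 1) (\<upsilon> + real b). \<bar>green \<upsilon> \<mu> \<alpha> b t s\<bar>)"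

text \<open>
  The second fractional difference is that of the shifted function \<open>\<lambda>s. y (s + \<upsilon> - \<mu>)\<close>, based at \<open>\<mu> - 1\<close>.
\<close>

definition bvp_solution ::
  "real \<Rightarrow> real \<Rightarrow> real \<Rightarrow> nat \<Rightarrow> (real \<times> real \<Rightarrow> real) \<Rightarrow> (real \<Rightarrow> real) \<Rightarrow> bool" where
  "bvp_solution \<upsilon> \<mu> \<alpha> b f y \<longleftrightarrow>
     (\<forall>t\<in>{0..b + 1}.
        - frac_diff (\<upsilon> - 2) \<upsilon> y (real t)
          + \<alpha> * frac_diff (\<mu> - 1) \<mu> (\<lambda>s. y (s + \<upsilon> - \<mu>)) (real t)
        = f (real t + \<upsilon> - 1, y (real t + \<upsilon> - 1)))
     \<and> y (\<upsilon> - 2) = 0 \<and> y (\<upsilon> + real b + 1) = 0"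

end

theory Submission
  imports Defs
begin

unbundle no vec_syntax and fps_syntax

text \<open>
  Existence needs no fixed point theorem in several dimensions, because the problem can be solved by
  shooting in one real parameter.

  Put \<open>z k = y (\<upsilon> - 1 + k)\<close>, so that \<open>y (\<upsilon> - 2) = 0\<close> is the value before \<open>z 0\<close>, and let \<open>Z\<close> be the
  generating function of \<open>z\<close>. A fractional difference of order \<open>\<nu>\<close> multiplies generating functions by
  $(1 - X)^\nu$ (\<open>frac_diff_fps\<close>), hence the equation at time \<open>n\<close> says that the coefficient of $X^{n+1}$ in
  \<open>K * Z\<close>, where $K = (1 - X)^\upsilon - \alpha (1 - X)^\mu$, is \<open>- h n (z n)\<close>; here \<open>h n r\<close> is
  \<open>f (n + \<upsilon> - 1, r)\<close>. Expanding $1 / K$ as a geometric series shows that its coefficients are the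
  Mittag-Leffler values \<open>e n\<close> (\<open>mittag_leffler_fps_inverse\<close>). So the solutions that satisfy the left
  boundary condition are exactly the sequences
  \<open>z n = e n * w - (\<Sum>s<n. e (n - 1 - s) * h s (z s))\<close>, with \<open>w\<close> free. This is an explicit recursion:
  \<open>w\<close> determines \<open>z\<close>, continuously.

  It remains to choose \<open>w\<close> so that \<open>z (b + 2) = 0\<close>. As \<open>h s r / r\<close> tends to \<open>m\<close>, the quotient \<open>z n / w\<close> tends to
  \<open>\<zeta> n\<close> as \<open>\<bar>w\<bar>\<close> grows, where \<open>\<zeta>\<close> solves the recursion for \<open>h s r = m * r\<close> and \<open>w = 1\<close>
  (\<open>trajectory_asymptotics\<close>). If \<open>\<zeta> (b + 2)\<close> were \<open>0\<close>, Green's function would give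
  \<open>\<zeta> n = (\<Sum>s<b + 2. G n s * (m * \<zeta> s))\<close>; the bound on \<open>\<bar>m\<bar>\<close> makes this a strict contraction of the maximum norm, so
  \<open>\<zeta> = 0\<close>, contrary to \<open>\<zeta> 0 = e 0 \<noteq> 0\<close> (\<open>linear_trajectory_nonzero\<close>). Hence \<open>z (b + 2)\<close> has opposite signs for
  large positive and large negative \<open>w\<close>, and the intermediate value theorem yields the zero.
\<close>

section \<open>Powers of $1 - X$\<close>

text \<open>
  The binomial series of $(1 - X)^a$. Its coefficients, with \<open>a\<close> negated, are the kernels of the fractional sums
  and the terms of the Mittag-Leffler series.
\<close>

definition one_minus_X_powr :: "real \<Rightarrow> real fps" where
  "one_minus_X_powr a = Abs_fps (\<lambda>n. pochhammer (- a) n / fact n)"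

lemma one_minus_X_powr_nth: "one_minus_X_powr a $ n = pochhammer (- a) n / fact n"
  by (simp add: one_minus_X_powr_def)

lemma one_minus_X_powr_add:
  "one_minus_X_powr (a + b) = one_minus_X_powr a * one_minus_X_powr b"
proof (rule fps_ext)
  fix n
  have "pochhammer (- a + - b) n / fact n =
      (\<Sum>k\<le>n. of_nat (n choose k) * pochhammer (- a) k * pochhammer (- b) (n - k) / fact n)"
    by (subst pochhammer_binomial_sum) (simp add: sum_divide_distrib)
  also have "\<dots> = (\<Sum>k\<le>n. (pochhammer (- a) k / fact k) * (pochhammer (- b) (n - k) / fact (n - k)))"
    by (intro sum.cong refl) (simp add: binomial_fact field_simps)
  finally show "one_minus_X_powr (a + b) $ n = (one_minus_X_powr a * one_minus_X_powr b) $ n"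
    by (simp add: one_minus_X_powr_nth fps_mult_nth atMost_atLeast0)
qed

lemma one_minus_X_powr_0 [simp]: "one_minus_X_powr 0 = 1"
  by (rule fps_ext) (simp add: one_minus_X_powr_nth pochhammer_0_left)

lemma one_minus_X_powr_1: "one_minus_X_powr 1 = 1 - fps_X"
proof (rule fps_ext)
  fix n
  show "one_minus_X_powr 1 $ n = (1 - fps_X) $ n"
  proof (cases "n \<le> 1")
    case True
    then consider "n = 0" | "n = 1" by linarith
    then show ?thesis by cases (auto simp: one_minus_X_powr_nth)
  next
    case False
    then have "pochhammer (- 1 :: real) n = 0"
      using pochhammer_of_nat_eq_0_lemma[of 1 n, where 'a = real] by simp
    with False show ?thesis by (simp add: one_minus_X_powr_nth)
  qed
qed

lemma one_minus_X_powr_of_nat: "one_minus_X_powr (real N) = (1 - fps_X) ^ N"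
  by (induction N) (simp_all add: one_minus_X_powr_add one_minus_X_powr_1)

section \<open>The generating function of the Mittag-Leffler function\<close>

text \<open>
  Each further factor of the Pochhammer symbol is affine in \<open>k\<close>, and multiplying the coefficients of a power
  series by \<open>k\<close> preserves convergence inside the unit disc, since it amounts to differentiating.
\<close>

lemma summable_power_times_pochhammer:
  fixes x p q :: real
  assumes "\<bar>x\<bar> < 1"
  shows "summable (\<lambda>k. x ^ k * pochhammer (real k * p + q) n)"
  using assms
proof (induction n arbitrary: x)
  case 0
  then show ?case by (simp add: summable_geometric)
next
  case (Suc n)
  define c where "c k = pochhammer (real k * p + q) n" for k
  have sm: "summable (\<lambda>k. c k * y ^ k)" if "norm y < 1" for y
    using Suc.IH[of y] that by (simp add: c_def mult.commute)
  have "summable (\<lambda>k. diffs c k * x ^ k)"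
    by (rule termdiff_converges[OF _ sm]) (use Suc.prems in auto)
  then have "summable (\<lambda>k. x * (diffs c k * x ^ k))"
    by (rule summable_mult)
  then have "summable (\<lambda>k. real (Suc k) * (c (Suc k) * x ^ Suc k))"
    by (simp add: diffs_def mult_ac)
  then have "summable (\<lambda>k. real k * (c k * x ^ k))"
    by (subst (asm) summable_Suc_iff)
  then have "summable (\<lambda>k. p * (real k * (c k * x ^ k)) + (q + real n) * (c k * x ^ k))"
    using sm[of x] Suc.prems by (intro summable_add summable_mult) auto
  moreover have "p * (real k * (c k * x ^ k)) + (q + real n) * (c k * x ^ k)
      = x ^ k * pochhammer (real k * p + q) (Suc n)" for k
    by (simp add: c_def pochhammer_Suc algebra_simps)
  ultimately show ?case by simp
qed

lemma summable_power_times_one_minus_X_powr: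
  assumes "\<bar>x\<bar> < 1"
  shows "summable (\<lambda>k. x ^ k * one_minus_X_powr (- (real k * p + q)) $ n)"
proof -
  have "summable (\<lambda>k. x ^ k * pochhammer (real k * p + q) n / fact n)"
    by (intro summable_divide summable_power_times_pochhammer assms)
  then show ?thesis by (simp add: one_minus_X_powr_nth add.commute)
qed

lemma Gamma_quotient_eq_one_minus_X_powr:
  assumes "0 < z"
  shows "Gamma (z + real n) / (Gamma z * Gamma (real n + 1)) = one_minus_X_powr (- z) $ n"
proof -
  have "z \<notin> \<int>\<^sub>\<le>\<^sub>0" using assms by (auto elim!: nonpos_Ints_cases)
  then show ?thesis
    by (simp add: one_minus_X_powr_nth pochhammer_Gamma Gamma_fact add.commute)
qed

lemma mittag_leffler_of_nat:
  assumes "0 \<le> p" and "0 < q"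
  shows "mittag_leffler p q x (real n) =
      (\<Sum>k. x ^ k * one_minus_X_powr (- (real k * p + q)) $ n)"
proof -
  have "falling (real n + real k * p + q - 1) (real k * p + q - 1) / Gamma (real k * p + q)
      = one_minus_X_powr (- (real k * p + q)) $ n" for k
  proof -
    have "0 < real k * p + q" using assms by (simp add: add_nonneg_pos)
    from Gamma_quotient_eq_one_minus_X_powr[OF this, of n] show ?thesis
      by (simp add: falling_def algebra_simps)
  qed
  then show ?thesis by (simp add: mittag_leffler_def)
qed

text \<open>
  Green's function subtracts this value at the last point of its case \<open>s \<le> t\<close>, so that the subtracted term may be
  summed over the strictly earlier points only.
\<close>

lemma mittag_leffler_minus_1: "mittag_leffler p q x (- 1) = 0"
  by (simp add: mittag_leffler_def falling_def)

text \<open>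
  The generating function of the Mittag-Leffler values is $\sum_k x^k (1 - X)^{-(kp+q)}$. Multiplication by
  $(1 - X)^q - x (1 - X)^{q-p}$ turns it into the telescoping sum of
  $x^k (1 - X)^{-kp} - x^{k+1} (1 - X)^{-(k+1)p}$, of which only the term $(1 - X)^0 = 1$ remains. For \<open>x \<noteq> 0\<close> the series
  does not converge as a formal power series, as all its terms have a nonzero constant coefficient; it is therefore summed
  in each coefficient separately.
\<close>

lemma mittag_leffler_fps_inverse:
  assumes "0 < p" and "0 < q" and "\<bar>x\<bar> < 1"
  shows "Abs_fps (\<lambda>n. mittag_leffler p q x (real n)) *
           (one_minus_X_powr q - fps_const x * one_minus_X_powr (q - p)) = 1"
    (is "?E * ?K = 1")
proof (rule fps_ext)
  fix n
  define u where "u k = x ^ k * one_minus_X_powr (- (real k * p)) $ n" for k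
  have "(\<lambda>k. x ^ k * one_minus_X_powr (- (real k * p + q)) $ i) sums (?E $ i)" for i
    using summable_power_times_one_minus_X_powr[OF assms(3)] assms
    by (simp add: mittag_leffler_of_nat summable_sums)
  then have "(\<lambda>k. \<Sum>i = 0..n. x ^ k * one_minus_X_powr (- (real k * p + q)) $ i * ?K $ (n - i))
      sums (\<Sum>i = 0..n. ?E $ i * ?K $ (n - i))"
    by (intro sums_sum sums_mult2)
  moreover have "(\<Sum>i = 0..n. x ^ k * one_minus_X_powr (- (real k * p + q)) $ i * ?K $ (n - i))
      = u k - u (Suc k)" for k
  proof -
    have "one_minus_X_powr (- (real k * p + q)) * ?K
        = one_minus_X_powr (- (real k * p + q) + q)
          - fps_const x * one_minus_X_powr (- (real k * p + q) + (q - p))"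
      unfolding one_minus_X_powr_add by (simp add: algebra_simps)
    also have "\<dots> = one_minus_X_powr (- (real k * p))
          - fps_const x * one_minus_X_powr (- (real (Suc k) * p))"
      by (simp add: algebra_simps)
    finally have "x ^ k * (one_minus_X_powr (- (real k * p + q)) * ?K) $ n
        = x ^ k * (one_minus_X_powr (- (real k * p))
            - fps_const x * one_minus_X_powr (- (real (Suc k) * p))) $ n"
      by (rule arg_cong)
    also have "\<dots> = u k - u (Suc k)"
      by (simp add: u_def right_diff_distrib mult_ac)
    finally have "x ^ k * (one_minus_X_powr (- (real k * p + q)) * ?K) $ n = u k - u (Suc k)" .
    then show ?thesis
      by (simp only: fps_mult_nth sum_distrib_left mult.assoc)
  qed
  ultimately have "(\<lambda>k. u k - u (Suc k)) sums ((?E * ?K) $ n)"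
    by (simp add: fps_mult_nth)
  moreover have "u \<longlonglongrightarrow> 0"
    using summable_LIMSEQ_zero[OF summable_power_times_one_minus_X_powr[OF assms(3), of p 0 n]]
    by (simp add: u_def[abs_def])
  then have "(\<lambda>k. u k - u (Suc k)) sums (u 0 - 0)"
    by (rule telescope_sums')
  ultimately have "(?E * ?K) $ n = u 0"
    using sums_unique2 by fastforce
  then show "(?E * ?K) $ n = 1 $ n"
    by (simp add: u_def)
qed

section \<open>Fractional differences as coefficients\<close>

lemma grid_eq_image: "grid a (a + real n) = (\<lambda>k. a + real k) ` {..n}"
  by (auto simp: grid_def grid_from_def)

lemma sum_grid: "(\<Sum>s\<in>grid a (a + real n). g s) = (\<Sum>k\<le>n. g (a + real k))"
  by (simp add: grid_eq_image sum.reindex inj_on_def)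

text \<open>
  A fractional sum is a convolution with the kernel \<open>\<Gamma>(\<nu> + j) / (\<Gamma>(\<nu>) * j!)\<close>, which is the coefficient of
  $X^j$ in $(1 - X)^{-\nu}$.
\<close>

lemma frac_sum_fps:
  assumes "0 \<le> \<nu>"
  shows "frac_sum a \<nu> f (a + \<nu> + real n)
      = (one_minus_X_powr (- \<nu>) * Abs_fps (\<lambda>k. f (a + real k))) $ n"
proof (cases "\<nu> = 0")
  case True
  then show ?thesis by (simp add: frac_sum_def)
next
  case False
  have "frac_sum a \<nu> f (a + \<nu> + real n)
      = 1 / Gamma \<nu> * (\<Sum>k\<le>n. falling (\<nu> + real n - real k - 1) (\<nu> - 1) * f (a + real k))"
    using False sum_grid[of "\<lambda>s. falling (a + \<nu> + real n - s - 1) (\<nu> - 1) * f s" a n]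
    by (simp add: frac_sum_def algebra_simps)
  also have "\<dots> = (\<Sum>k\<le>n. f (a + real k) * one_minus_X_powr (- \<nu>) $ (n - k))"
  proof (subst sum_distrib_left, rule sum.cong[OF refl])
    fix k assume "k \<in> {..n}"
    with False assms show "1 / Gamma \<nu> * (falling (\<nu> + real n - real k - 1) (\<nu> - 1) * f (a + real k))
        = f (a + real k) * one_minus_X_powr (- \<nu>) $ (n - k)"
      using Gamma_quotient_eq_one_minus_X_powr[of \<nu> "n - k"]
      by (simp add: falling_def algebra_simps flip: times_divide_eq_right)
  qed
  also have "\<dots> = (Abs_fps (\<lambda>k. f (a + real k)) * one_minus_X_powr (- \<nu>)) $ n"
    by (simp add: fps_mult_nth atMost_atLeast0)
  finally show ?thesis by (simp add: mult.commute)
qed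

text \<open>
  The forward difference multiplies by $1 - X$ and shifts the index by one, because
  \<open>A $ (n + 1) - A $ n\<close> is the coefficient of $X^{n+1}$ in \<open>(1 - X) * A\<close>.
\<close>

lemma funpow_fdiff_fps:
  assumes "\<And>n. g (c + real n) = A $ n"
  shows "(fdiff ^^ N) g (c + real n) = ((1 - fps_X) ^ N * A) $ (n + N)"
proof (induction N arbitrary: n)
  case 0
  then show ?case by (simp add: assms)
next
  case (Suc N)
  have "(fdiff ^^ Suc N) g (c + real n) =
      (fdiff ^^ N) g (c + real (Suc n)) - (fdiff ^^ N) g (c + real n)"
    by (simp add: fdiff_def algebra_simps)
  also have "\<dots> = ((1 - fps_X) ^ N * A) $ (n + Suc N) - (fps_X * ((1 - fps_X) ^ N * A)) $ (n + Suc N)"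
    unfolding Suc.IH by simp
  also have "\<dots> = ((1 - fps_X) ^ Suc N * A) $ (n + Suc N)"
    by (simp add: algebra_simps)
  finally show ?case .
qed

lemma frac_diff_fps:
  assumes "0 < \<nu>" and N: "N = nat \<lceil>\<nu>\<rceil>"
  shows "frac_diff a \<nu> f (a + (real N - \<nu>) + real n)
      = (one_minus_X_powr \<nu> * Abs_fps (\<lambda>k. f (a + real k))) $ (n + N)"
proof -
  have "0 \<le> real N - \<nu>" using assms by linarith
  note S = frac_sum_fps[OF this, of a f]
  have "frac_diff a \<nu> f (a + (real N - \<nu>) + real n)
      = ((1 - fps_X) ^ N * (one_minus_X_powr (- (real N - \<nu>)) * Abs_fps (\<lambda>k. f (a + real k)))) $ (n + N)"
    unfolding frac_diff_def N[symmetric] Let_def by (rule funpow_fdiff_fps) (rule S)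
  also have "\<dots> = (one_minus_X_powr (real N + - (real N - \<nu>)) * Abs_fps (\<lambda>k. f (a + real k))) $ (n + N)"
    unfolding one_minus_X_powr_add one_minus_X_powr_of_nat by (simp add: mult.assoc)
  finally show ?thesis by simp
qed

text \<open>
  The first difference is based one step before the second one, at a zero of \<open>y\<close>. Its generating function
  therefore carries a factor \<open>X\<close>, which makes up for its order being rounded up to 2 instead of 1, so that both
  differences contribute to the same coefficient.
\<close>

lemma bvp_operator_fps:
  assumes "1 < \<upsilon>" and "\<upsilon> < 2" and "0 < \<mu>" and "\<mu> < 1" and y0: "y (\<upsilon> - 2) = 0"
  shows "frac_diff (\<upsilon> - 2) \<upsilon> y (real n)
           - \<alpha> * frac_diff (\<mu> - 1) \<mu> (\<lambda>s. y (s + \<upsilon> - \<mu>)) (real n)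
      = ((one_minus_X_powr \<upsilon> - fps_const \<alpha> * one_minus_X_powr \<mu>)
          * Abs_fps (\<lambda>k. y (\<upsilon> - 1 + real k))) $ Suc n"
proof -
  let ?Z = "Abs_fps (\<lambda>k. y (\<upsilon> - 1 + real k))"
  have c\<upsilon>: "2 = nat \<lceil>\<upsilon>\<rceil>" and c\<mu>: "1 = nat \<lceil>\<mu>\<rceil>"
    using assms by linarith+
  have "Abs_fps (\<lambda>k. y (\<upsilon> - 2 + real k)) = fps_X * ?Z"
  proof (rule fps_ext)
    fix k show "Abs_fps (\<lambda>k. y (\<upsilon> - 2 + real k)) $ k = (fps_X * ?Z) $ k"
      using y0 by (cases k) (simp_all add: algebra_simps)
  qed
  then have "frac_diff (\<upsilon> - 2) \<upsilon> y (real n) = (one_minus_X_powr \<upsilon> * (fps_X * ?Z)) $ (n + 2)"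
    using frac_diff_fps[OF _ c\<upsilon>, of "\<upsilon> - 2" y n] assms by simp
  also have "\<dots> = (fps_X * (one_minus_X_powr \<upsilon> * ?Z)) $ (n + 2)"
    by (simp only: mult.left_commute)
  also have "\<dots> = (one_minus_X_powr \<upsilon> * ?Z) $ Suc n"
    by simp
  finally have 1: "frac_diff (\<upsilon> - 2) \<upsilon> y (real n) = (one_minus_X_powr \<upsilon> * ?Z) $ Suc n" .
  have "(\<lambda>k. y (\<mu> - 1 + real k + \<upsilon> - \<mu>)) = (\<lambda>k. y (\<upsilon> - 1 + real k))"
    by (simp add: algebra_simps)
  then have 2: "frac_diff (\<mu> - 1) \<mu> (\<lambda>s. y (s + \<upsilon> - \<mu>)) (real n) = (one_minus_X_powr \<mu> * ?Z) $ Suc n"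
    using frac_diff_fps[OF _ c\<mu>, of "\<mu> - 1" "\<lambda>s. y (s + \<upsilon> - \<mu>)" n] assms by simp
  have "((one_minus_X_powr \<upsilon> - fps_const \<alpha> * one_minus_X_powr \<mu>) * ?Z) $ Suc n
      = (one_minus_X_powr \<upsilon> * ?Z) $ Suc n - \<alpha> * (one_minus_X_powr \<mu> * ?Z) $ Suc n"
    by (simp only: left_diff_distrib mult.assoc fps_sub_nth fps_mult_left_const_nth)
  with 1 2 show ?thesis by simp
qed

section \<open>Shooting\<close>

text \<open>
  In the application \<open>w\<close> is the constant coefficient of \<open>K * Z\<close>, the one that the difference
  equation leaves free.
\<close>

function trajectory :: "(nat \<Rightarrow> real) \<Rightarrow> (nat \<Rightarrow> real \<Rightarrow> real) \<Rightarrow> real \<Rightarrow> nat \<Rightarrow> real" where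
  "trajectory e h w n = e n * w - (\<Sum>s<n. e (n - 1 - s) * h s (trajectory e h w s))"
  by auto
termination by (relation "Wellfounded.measure (\<lambda>(e, h, w, n). n)") auto

declare trajectory.simps [simp del]

definition discrete_green :: "(nat \<Rightarrow> real) \<Rightarrow> nat \<Rightarrow> nat \<Rightarrow> nat \<Rightarrow> real" where
  "discrete_green e N n s =
     e n / e N * e (N - 1 - s) - (if s < n then e (n - 1 - s) else 0)"

text \<open>
  The end condition \<open>trajectory e h w N = 0\<close> determines \<open>w\<close> in terms of the forcing values; substituting it into the
  recursion produces Green's function.
\<close>

lemma trajectory_eq_green_sum:
  assumes "e N \<noteq> 0" and "trajectory e h w N = 0" and "n \<le> N"
  shows "trajectory e h w n = (\<Sum>s<N. discrete_green e N n s * h s (trajectory e h w s))"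
proof -
  let ?H = "\<lambda>s. h s (trajectory e h w s)"
  have w: "(\<Sum>s<N. e (N - 1 - s) * ?H s) = e N * w"
    using assms(2) by (subst (asm) trajectory.simps) simp
  have "(\<Sum>s<N. discrete_green e N n s * ?H s)
      = (\<Sum>s<N. e n / e N * (e (N - 1 - s) * ?H s))
        - (\<Sum>s<N. if s < n then e (n - 1 - s) * ?H s else 0)"
    unfolding sum_subtractf[symmetric]
    by (rule sum.cong) (auto simp: discrete_green_def algebra_simps)
  also have "(\<Sum>s<N. if s < n then e (n - 1 - s) * ?H s else 0) = (\<Sum>s<n. e (n - 1 - s) * ?H s)"
    using assms(3) by (intro sum.mono_neutral_cong_right) auto
  also have "(\<Sum>s<N. e n / e N * (e (N - 1 - s) * ?H s)) = e n * w"
    unfolding sum_distrib_left[symmetric] w using assms(1) by simp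
  finally show ?thesis by (subst trajectory.simps) simp
qed

lemma continuous_on_trajectory:
  assumes "\<And>s. s < n \<Longrightarrow> continuous_on UNIV (h s)"
  shows "continuous_on UNIV (\<lambda>w. trajectory e h w n)"
  using assms
proof (induction n rule: less_induct)
  case (less n)
  have "continuous_on UNIV (\<lambda>w. h s (trajectory e h w s))" if "s < n" for s
  proof (rule continuous_on_compose2[of UNIV "h s"])
    show "continuous_on UNIV (h s)" using that by (rule less.prems)
    show "continuous_on UNIV (\<lambda>w. trajectory e h w s)"
      using that less.prems by (intro less.IH) auto
  qed simp
  then show ?case
    by (subst trajectory.simps) (intro continuous_intros, auto)
qed

text \<open>
  If \<open>z = 0\<close>, then \<open>g\<close> need not tend to infinity, so the quotient cannot be split into \<open>h (g w) / g w\<close> and \<open>g w / w\<close>.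
  Instead, \<open>h r - m * r\<close> is bounded by \<open>\<epsilon> * \<bar>r\<bar> + C\<close> for every \<open>\<epsilon> > 0\<close>, by the limit for large \<open>\<bar>r\<bar>\<close> and by compactness for
  the other \<open>r\<close>; after division by \<open>w\<close> this bound is arbitrarily small.
\<close>

lemma filterlim_quotient_compose:
  fixes h g :: "real \<Rightarrow> real"
  assumes cont: "continuous_on UNIV h"
    and h: "((\<lambda>r. h r / r) \<longlongrightarrow> m) at_infinity"
    and g: "((\<lambda>w. g w / w) \<longlongrightarrow> z) at_infinity"
  shows "((\<lambda>w. h (g w) / w) \<longlongrightarrow> m * z) at_infinity"
proof -
  define k where "k r = h r - m * r" for r
  have k_bound: "\<exists>C. \<forall>r. \<bar>k r\<bar> \<le> \<epsilon> * \<bar>r\<bar> + C" if "0 < \<epsilon>" for \<epsilon>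
  proof -
    from tendstoD[OF h that] obtain B where B: "\<And>r. B \<le> \<bar>r\<bar> \<Longrightarrow> dist (h r / r) m < \<epsilon>"
      by (auto simp: eventually_at_infinity)
    have "compact (k ` {- \<bar>B\<bar> - 1..\<bar>B\<bar> + 1})"
      unfolding k_def using cont
      by (intro compact_continuous_image continuous_intros) (auto intro: continuous_on_subset)
    then have "bounded (k ` {- \<bar>B\<bar> - 1..\<bar>B\<bar> + 1})"
      by (rule compact_imp_bounded)
    then obtain C where "\<forall>x \<in> k ` {- \<bar>B\<bar> - 1..\<bar>B\<bar> + 1}. norm x \<le> C"
      unfolding bounded_iff by blast
    then have C: "\<bar>k r\<bar> \<le> C" if "r \<in> {- \<bar>B\<bar> - 1..\<bar>B\<bar> + 1}" for r
      using that by (metis imageI real_norm_def)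
    have "\<bar>k r\<bar> \<le> \<epsilon> * \<bar>r\<bar> + \<bar>C\<bar>" for r
    proof (cases "\<bar>r\<bar> \<le> \<bar>B\<bar> + 1")
      case True
      then have "\<bar>k r\<bar> \<le> C" by (intro C) auto
      then show ?thesis using that by (smt (verit) mult_nonneg_nonneg)
    next
      case False
      then have "r \<noteq> 0" and "dist (h r / r) m < \<epsilon>" using B[of r] by auto
      then have "\<bar>k r / r\<bar> \<le> \<epsilon>" by (simp add: k_def dist_real_def diff_divide_distrib)
      with \<open>r \<noteq> 0\<close> show ?thesis by (simp add: divide_le_eq)
    qed
    then show ?thesis by blast
  qed
  have "((\<lambda>w. k (g w) / w) \<longlongrightarrow> 0) at_infinity"
  proof (rule tendstoI)
    fix \<epsilon> :: real assume \<epsilon>: "0 < \<epsilon>"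
    define \<delta> where "\<delta> = \<epsilon> / (\<bar>z\<bar> + 1)"
    have \<delta>: "0 < \<delta>" using \<epsilon> by (simp add: \<delta>_def add_nonneg_pos)
    obtain C where C: "\<And>r. \<bar>k r\<bar> \<le> \<delta> * \<bar>r\<bar> + C" using k_bound[OF \<delta>] by blast
    have "((\<lambda>w. \<delta> * \<bar>g w / w\<bar> + C / \<bar>w\<bar>) \<longlongrightarrow> \<delta> * \<bar>z\<bar> + 0) at_infinity"
    proof (intro tendsto_add tendsto_mult tendsto_const tendsto_rabs g)
      have "((\<lambda>w::real. C * inverse (norm w)) \<longlongrightarrow> C * 0) at_infinity"
        by (intro tendsto_mult tendsto_const tendsto_inverse_0_at_top filterlim_norm_at_top)
      then show "((\<lambda>w::real. C / \<bar>w\<bar>) \<longlongrightarrow> 0) at_infinity" by (simp add: divide_inverse)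
    qed
    moreover have "\<delta> * \<bar>z\<bar> + 0 < \<epsilon>"
      using \<epsilon> by (simp add: \<delta>_def divide_simps)
    ultimately have "eventually (\<lambda>w. \<delta> * \<bar>g w / w\<bar> + C / \<bar>w\<bar> < \<epsilon>) at_infinity"
      by (rule order_tendstoD(2))
    then show "eventually (\<lambda>w. dist (k (g w) / w) 0 < \<epsilon>) at_infinity"
    proof eventually_elim
      case (elim w)
      have "\<bar>k (g w)\<bar> / \<bar>w\<bar> \<le> (\<delta> * \<bar>g w\<bar> + C) / \<bar>w\<bar>" by (intro divide_right_mono C) simp
      with elim show ?case by (simp add: add_divide_distrib)
    qed
  qed
  then have "((\<lambda>w. m * (g w / w) + k (g w) / w) \<longlongrightarrow> m * z + 0) at_infinity"
    by (intro tendsto_add tendsto_mult tendsto_const g)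
  then show ?thesis by (simp add: k_def diff_divide_distrib)
qed

lemma trajectory_asymptotics:
  assumes "\<And>s. s < n \<Longrightarrow> continuous_on UNIV (h s)"
    and "\<And>s. s < n \<Longrightarrow> ((\<lambda>r. h s r / r) \<longlongrightarrow> m) at_infinity"
  shows "((\<lambda>w. trajectory e h w n / w) \<longlongrightarrow> trajectory e (\<lambda>_ r. m * r) 1 n) at_infinity"
  using assms
proof (induction n rule: less_induct)
  case (less n)
  have "((\<lambda>w. e n - (\<Sum>s<n. e (n - 1 - s) * (h s (trajectory e h w s) / w)))
      \<longlongrightarrow> e n - (\<Sum>s<n. e (n - 1 - s) * (m * trajectory e (\<lambda>_ r. m * r) 1 s))) at_infinity"
    using less.prems less.IH
    by (intro tendsto_intros filterlim_quotient_compose) auto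
  then have "((\<lambda>w. e n - (\<Sum>s<n. e (n - 1 - s) * (h s (trajectory e h w s) / w)))
      \<longlongrightarrow> trajectory e (\<lambda>_ r. m * r) 1 n) at_infinity"
    by (subst trajectory.simps) simp
  moreover have "eventually (\<lambda>w::real. w \<noteq> 0) at_infinity"
    by (auto simp: eventually_at_infinity intro!: exI[of _ 1])
  then have "eventually (\<lambda>w. e n - (\<Sum>s<n. e (n - 1 - s) * (h s (trajectory e h w s) / w))
      = trajectory e h w n / w) at_infinity"
  proof eventually_elim
    case (elim w)
    then show ?case
      by (subst (2) trajectory.simps) (simp add: diff_divide_distrib sum_divide_distrib)
  qed
  ultimately show ?case by (rule Lim_transform_eventually)
qed

text \<open>
  Uniqueness for the linear boundary value problem: at an index where \<open>\<bar>\<zeta>\<bar>\<close> is maximal, the representation by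
  Green's function would bound the maximum by a multiple of itself with a factor less than 1.
\<close>

lemma linear_trajectory_nonzero:
  assumes "e 0 \<noteq> 0" and "e N \<noteq> 0"
    and small: "\<And>n. n \<le> N \<Longrightarrow> \<bar>m\<bar> * (\<Sum>s<N. \<bar>discrete_green e N n s\<bar>) < 1"
  shows "trajectory e (\<lambda>_ r. m * r) 1 N \<noteq> 0"
proof
  let ?z = "trajectory e (\<lambda>_ r. m * r) 1"
  assume zN: "?z N = 0"
  have "Max ((\<lambda>n. \<bar>?z n\<bar>) ` {..N}) \<in> (\<lambda>n. \<bar>?z n\<bar>) ` {..N}" by (intro Max_in) auto
  then obtain n where n: "Max ((\<lambda>n. \<bar>?z n\<bar>) ` {..N}) = \<bar>?z n\<bar>" "n \<in> {..N}"
    by (rule imageE)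
  from n(2) have nN: "n \<le> N" by simp
  have max: "\<bar>?z s\<bar> \<le> \<bar>?z n\<bar>" if "s \<le> N" for s
    unfolding n(1)[symmetric] using that by (intro Max_ge) auto
  have "?z 0 = e 0" by (subst trajectory.simps) simp
  with assms(1) max[of 0] have pos: "0 < \<bar>?z n\<bar>" by simp
  have "\<bar>?z n\<bar> = \<bar>\<Sum>s<N. discrete_green e N n s * (m * ?z s)\<bar>"
    using trajectory_eq_green_sum[where h = "\<lambda>_ r. m * r", OF assms(2) zN nN] by simp
  also have "\<dots> \<le> (\<Sum>s<N. \<bar>discrete_green e N n s\<bar> * (\<bar>m\<bar> * \<bar>?z n\<bar>))"
    by (intro order.trans[OF sum_abs] sum_mono)
      (auto simp: abs_mult intro!: mult_left_mono max)
  also have "\<dots> = (\<bar>m\<bar> * (\<Sum>s<N. \<bar>discrete_green e N n s\<bar>)) * \<bar>?z n\<bar>"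
    by (simp add: sum_distrib_left sum_distrib_right mult_ac)
  also have "\<dots> < 1 * \<bar>?z n\<bar>"
    using small[OF nN] pos by (rule mult_strict_right_mono)
  finally show False by simp
qed

lemma continuous_asymptotically_linear_has_zero:
  fixes F :: "real \<Rightarrow> real"
  assumes "continuous_on UNIV F" and "((\<lambda>w. F w / w) \<longlongrightarrow> z) at_infinity" and "z \<noteq> 0"
  shows "\<exists>w. F w = 0"
proof -
  from tendstoD[OF assms(2), of "\<bar>z\<bar>"] assms(3)
  obtain B where B: "\<And>w. B \<le> \<bar>w\<bar> \<Longrightarrow> \<bar>F w / w - z\<bar> < \<bar>z\<bar>"
    by (auto simp: eventually_at_infinity dist_real_def)
  define R where "R = \<bar>B\<bar> + 1"
  have R: "0 < R" by (simp add: R_def)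
  have a: "\<bar>F R / R - z\<bar> < \<bar>z\<bar>" and b: "\<bar>- (F (- R) / R) - z\<bar> < \<bar>z\<bar>"
  proof -
    have "B \<le> \<bar>R\<bar>" "B \<le> \<bar>- R\<bar>" by (auto simp: R_def)
    then show "\<bar>F R / R - z\<bar> < \<bar>z\<bar>" "\<bar>- (F (- R) / R) - z\<bar> < \<bar>z\<bar>"
      using B[of R] B[of "- R"] by simp_all
  qed
  have cont: "continuous_on {- R..R} F" using assms(1) by (rule continuous_on_subset) simp
  show ?thesis
  proof (cases "0 < z")
    case True
    then have "0 < F R / R" "F (- R) / R < 0" using a b by linarith+
    then have "F (- R) \<le> 0" "0 \<le> F R" using R by (auto simp: zero_less_divide_iff divide_less_0_iff)
    then show ?thesis using IVT'[of F "- R" 0 R] R cont by auto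
  next
    case False
    then have "F R / R < 0" "0 < F (- R) / R" using a b assms(3) by linarith+
    then have "0 \<le> F (- R)" "F R \<le> 0" using R by (auto simp: zero_less_divide_iff divide_less_0_iff)
    then show ?thesis using IVT2'[of F R 0 "- R"] R cont by auto
  qed
qed

lemma shooting:
  assumes "e 0 \<noteq> 0" and "e N \<noteq> 0"
    and "\<And>n. n \<le> N \<Longrightarrow> \<bar>m\<bar> * (\<Sum>s<N. \<bar>discrete_green e N n s\<bar>) < 1"
    and "\<And>s. s < N \<Longrightarrow> continuous_on UNIV (h s)"
    and "\<And>s. s < N \<Longrightarrow> ((\<lambda>r. h s r / r) \<longlongrightarrow> m) at_infinity"
  shows "\<exists>w. trajectory e h w N = 0"
proof (rule continuous_asymptotically_linear_has_zero)
  show "continuous_on UNIV (\<lambda>w. trajectory e h w N)"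
    using assms(4) by (rule continuous_on_trajectory)
  show "((\<lambda>w. trajectory e h w N / w) \<longlongrightarrow> trajectory e (\<lambda>_ r. m * r) 1 N) at_infinity"
    using assms(4,5) by (rule trajectory_asymptotics)
  show "trajectory e (\<lambda>_ r. m * r) 1 N \<noteq> 0"
    using assms(1-3) by (rule linear_trajectory_nonzero)
qed

text \<open>
  The recursion says that the generating function is \<open>E * (w - X * H)\<close>, where \<open>E\<close> is the inverse of \<open>K\<close> and \<open>H\<close> collects
  the forcing values; multiplying by \<open>K\<close> leaves \<open>w - X * H\<close>.
\<close>

lemma trajectory_fps:
  assumes "Abs_fps e * K = 1"
  shows "(K * Abs_fps (trajectory e h w)) $ Suc n = - h n (trajectory e h w n)"
proof -
  define H where "H = Abs_fps (\<lambda>s. h s (trajectory e h w s))"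
  have "Abs_fps (trajectory e h w) = Abs_fps e * (fps_const w - fps_X * H)"
  proof (rule fps_ext)
    fix n
    have "(fps_X * (Abs_fps e * H)) $ n = (\<Sum>s<n. e (n - 1 - s) * h s (trajectory e h w s))"
    proof (cases n)
      case (Suc n')
      have "(Abs_fps e * H) $ n' = (H * Abs_fps e) $ n'" by (simp add: mult.commute)
      also have "\<dots> = (\<Sum>s\<le>n'. e (n' - s) * h s (trajectory e h w s))"
        unfolding H_def fps_mult_nth atMost_atLeast0 by (intro sum.cong) simp_all
      finally show ?thesis using Suc by (simp add: lessThan_Suc_atMost)
    qed simp
    then have "trajectory e h w n = e n * w - (fps_X * (Abs_fps e * H)) $ n"
      by (subst trajectory.simps) (simp only:)
    also have "\<dots> = (Abs_fps e * fps_const w - fps_X * (Abs_fps e * H)) $ n"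
      by (simp only: fps_sub_nth fps_mult_right_const_nth fps_nth_Abs_fps)
    also have "Abs_fps e * fps_const w - fps_X * (Abs_fps e * H) = Abs_fps e * (fps_const w - fps_X * H)"
      by (simp only: right_diff_distrib mult.left_commute)
    finally show "Abs_fps (trajectory e h w) $ n = (Abs_fps e * (fps_const w - fps_X * H)) $ n"
      by (simp only: fps_nth_Abs_fps)
  qed
  then have "K * Abs_fps (trajectory e h w) = (Abs_fps e * K) * (fps_const w - fps_X * H)"
    by (simp add: mult_ac)
  with assms show ?thesis by (simp add: H_def)
qed

section \<open>The boundary value problem\<close>

lemma green_eq_discrete_green:
  assumes "s < b + 2"
  shows "green \<upsilon> \<mu> \<alpha> b (\<upsilon> - 1 + real n) (\<upsilon> - 1 + real s)
    = discrete_green (\<lambda>k. mittag_leffler (\<upsilon> - \<mu>) \<upsilon> \<alpha> (real k)) (b + 2) n s"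
proof -
  have "\<upsilon> + real b - (\<upsilon> - 1 + real s) = real (b + 2 - 1 - s)" using assms by simp
  moreover have "real n - real s - 1 = real (n - 1 - s)" if "s < n" using that by simp
  moreover have "s < n \<or> s = n \<or> n < s" by linarith
  ultimately show ?thesis
    by (auto simp: green_def discrete_green_def Let_def mittag_leffler_minus_1 add.commute diff_diff_eq)
qed

lemma green_bound_imp:
  assumes "\<bar>m\<bar> < green_bound \<upsilon> \<mu> \<alpha> b" and "n \<le> b + 2"
  shows "\<bar>m\<bar> * (\<Sum>s<b + 2. \<bar>discrete_green (\<lambda>k. mittag_leffler (\<upsilon> - \<mu>) \<upsilon> \<alpha> (real k)) (b + 2) n s\<bar>) < 1"
proof -
  let ?S = "\<lambda>t. \<Sum>s\<in>grid (\<upsilon> - 1) (\<upsilon> + real b). \<bar>green \<upsilon> \<mu> \<alpha> b t s\<bar>"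
  let ?T = "grid (\<upsilon> - 2) (\<upsilon> + real b + 1)"
  have T: "?T = (\<lambda>k. \<upsilon> - 2 + real k) ` {..b + 3}"
    using grid_eq_image[of "\<upsilon> - 2" "b + 3"] by (simp add: algebra_simps)
  have "\<upsilon> - 1 + real n = \<upsilon> - 2 + real (Suc n)" by simp
  then have "\<upsilon> - 1 + real n \<in> ?T" unfolding T using assms(2) by (intro image_eqI[of _ _ "Suc n"]) auto
  then have le: "?S (\<upsilon> - 1 + real n) \<le> Max (?S ` ?T)" unfolding T by (intro Max_ge) auto
  have "?S (\<upsilon> - 1 + real n) = (\<Sum>s\<le>b + 1. \<bar>green \<upsilon> \<mu> \<alpha> b (\<upsilon> - 1 + real n) (\<upsilon> - 1 + real s)\<bar>)"
    using sum_grid[of "\<lambda>s. \<bar>green \<upsilon> \<mu> \<alpha> b (\<upsilon> - 1 + real n) s\<bar>" "\<upsilon> - 1" "b + 1"]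
    by (simp add: algebra_simps)
  also have "\<dots> = (\<Sum>s<b + 2. \<bar>discrete_green (\<lambda>k. mittag_leffler (\<upsilon> - \<mu>) \<upsilon> \<alpha> (real k)) (b + 2) n s\<bar>)"
    by (rule sum.cong) (auto simp: green_eq_discrete_green)
  finally have S: "?S (\<upsilon> - 1 + real n) = \<dots>" .
  \<comment> \<open>the maximum is positive: otherwise its reciprocal would be at most \<open>0\<close>, and not exceed \<open>\<bar>m\<bar>\<close>\<close>
  have m: "\<bar>m\<bar> < 1 / Max (?S ` ?T)" using assms(1) by (simp add: green_bound_def)
  then have "0 < 1 / Max (?S ` ?T)" by (rule le_less_trans[OF abs_ge_zero])
  then have "0 < Max (?S ` ?T)" by (simp only: zero_less_divide_1_iff)
  then have "\<bar>m\<bar> * Max (?S ` ?T) < 1" using m by (simp add: less_divide_eq)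
  moreover have "\<bar>m\<bar> * ?S (\<upsilon> - 1 + real n) \<le> \<bar>m\<bar> * Max (?S ` ?T)"
    using le by (rule mult_left_mono) simp
  ultimately show ?thesis unfolding S by simp
qed

theorem theorem11:
  fixes \<upsilon> \<mu> \<alpha> m :: real and b :: nat and f :: "real \<times> real \<Rightarrow> real"
  assumes "1 < \<upsilon>" and "\<upsilon> < 2"
    and "0 < \<mu>" and "\<mu> < 1"
    and "b \<ge> 1"
    and "\<bar>\<alpha>\<bar> < 1"
    and "mittag_leffler (\<upsilon> - \<mu>) \<upsilon> \<alpha> (real b + 2) \<noteq> 0"
    and "continuous_on (grid (\<upsilon> - 1) (\<upsilon> + real b) \<times> UNIV) f"
    and "\<And>t. t \<in> {0..b + 1} \<Longrightarrow>
           ((\<lambda>r. f (real t + \<upsilon> - 1, r) / r) \<longlongrightarrow> m) at_infinity"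
    and "\<bar>m\<bar> < green_bound \<upsilon> \<mu> \<alpha> b"
  shows "\<exists>y. bvp_solution \<upsilon> \<mu> \<alpha> b f y \<and>
           ((\<exists>t\<in>{0..b + 1}. f (real t + \<upsilon> - 1, 0) \<noteq> 0) \<longrightarrow>
             (\<exists>t\<in>grid (\<upsilon> - 2) (\<upsilon> + real b + 1). y t \<noteq> 0))"
proof -
  define e where "e k = mittag_leffler (\<upsilon> - \<mu>) \<upsilon> \<alpha> (real k)" for k
  define h where "h s r = f (real s + \<upsilon> - 1, r)" for s r
  define K where "K = one_minus_X_powr \<upsilon> - fps_const \<alpha> * one_minus_X_powr \<mu>"
  have EK: "Abs_fps e * K = 1"
    using mittag_leffler_fps_inverse[of "\<upsilon> - \<mu>" \<upsilon> \<alpha>] assms by (simp add: e_def[abs_def] K_def)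
  then have "(Abs_fps e * K) $ 0 = 1" by simp
  then have e0: "e 0 \<noteq> 0" by auto
  have eN: "e (b + 2) \<noteq> 0" using assms(7) by (simp add: e_def add.commute)
  have "continuous_on UNIV (h s)" if "s < b + 2" for s
  proof -
    have "grid (\<upsilon> - 1) (\<upsilon> + real b) = (\<lambda>k. \<upsilon> - 1 + real k) ` {..b + 1}"
      using grid_eq_image[of "\<upsilon> - 1" "b + 1"] by (simp add: algebra_simps)
    then have "real s + \<upsilon> - 1 \<in> grid (\<upsilon> - 1) (\<upsilon> + real b)"
      using that by (auto intro!: image_eqI[of _ _ s])
    then show ?thesis unfolding h_def
      by (intro continuous_on_compose2[OF assms(8)] continuous_intros) auto
  qed
  moreover have "((\<lambda>r. h s r / r) \<longlongrightarrow> m) at_infinity" if "s < b + 2" for s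
    unfolding h_def using assms(9)[of s] that by simp
  ultimately obtain w where w: "trajectory e h w (b + 2) = 0"
    using shooting[OF e0 eN, of m h] green_bound_imp[OF assms(10)] unfolding e_def by blast
  define y where "y t = (if t < \<upsilon> - 1 then 0 else trajectory e h w (nat \<lfloor>t - (\<upsilon> - 1)\<rfloor>))" for t
  have y_grid: "y (\<upsilon> - 1 + real k) = trajectory e h w k" for k
    by (simp add: y_def)
  have y0: "y (\<upsilon> - 2) = 0" by (simp add: y_def)
  have op: "- frac_diff (\<upsilon> - 2) \<upsilon> y (real t)
          + \<alpha> * frac_diff (\<mu> - 1) \<mu> (\<lambda>s. y (s + \<upsilon> - \<mu>)) (real t)
      = - ((K * Abs_fps (trajectory e h w)) $ Suc t)" for t
    using bvp_operator_fps[where y = y and n = t and \<alpha> = \<alpha>, OF assms(1-4) y0]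
    by (simp add: K_def y_grid)
  have eq: "(K * Abs_fps (trajectory e h w)) $ Suc t = - h t (trajectory e h w t)" for t
    by (rule trajectory_fps[OF EK])
  have "y (real t + \<upsilon> - 1) = trajectory e h w t" for t
    using y_grid[of t] by (simp add: algebra_simps)
  moreover have "y (\<upsilon> + real b + 1) = 0"
    using y_grid[of "b + 2"] w by (simp add: algebra_simps)
  ultimately have sol: "bvp_solution \<upsilon> \<mu> \<alpha> b f y"
    unfolding bvp_solution_def op eq using y0 by (simp add: h_def)
  have "\<exists>t\<in>grid (\<upsilon> - 2) (\<upsilon> + real b + 1). y t \<noteq> 0"
    if t: "t \<in> {0..b + 1}" and "f (real t + \<upsilon> - 1, 0) \<noteq> 0" for t
  proof (rule ccontr)
    assume *: "\<not> ?thesis"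
    have z: "trajectory e h w k = 0" if "k \<le> b + 2" for k
    proof -
      have "\<upsilon> - 1 + real k \<in> grid (\<upsilon> - 2) (\<upsilon> + real b + 1)"
        using that by (auto simp: grid_def grid_from_def intro!: exI[of _ "Suc k"])
      with * show ?thesis using y_grid by metis
    qed
    \<comment> \<open>the coefficient involves only the values at indices up to \<open>t + 1 \<le> b + 2\<close>\<close>
    have "(K * Abs_fps (trajectory e h w)) $ Suc t = 0"
      unfolding fps_mult_nth using t by (intro sum.neutral) (auto simp: z)
    with eq[of t] z[of t] t that(2) show False by (simp add: h_def)
  qed
  with sol show ?thesis by blast
qed

end
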